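(* Let $b\geq 2$ be an integer such that $b+1$ is not a power of $2$, and let $\alpha$ and $\beta$ be integers with $\alpha\beta\neq 0$. Let $q\geq 5$ be a prime, and let $\mathcal{C}$ be a $b$-primitive covering system consisting of exactly one congruence for each of the moduli $2^j$ with $1\leq j\leq q-1$ and $2^jq$ with $0\leq j\leq q-1$. Let $\mathcal{P}_b(\mathcal{C})$ be an associated set of primitive prime divisors, and let $M=\operatorname{lcm}\left(\{2^{q-1},\,b-1,\,q\}\cup\mathcal{P}_b(\mathcal{C})\right)$. Then there exists an integer $T$ such that for all nonnegative integers $t\equiv T\pmod{M}$ with $tb^t+\alpha>0$ and $(tb^t+\alpha)b+\beta\geq\max \mathcal{P}_b(\mathcal{C})$, we have $\gcd(tb^t+\alpha+\beta,\,b-1)=1$ and $(tb^t+\alpha)b^n+\beta$ is composite for all positive integers $n$.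
   Context: A covering system (of the integers) is a finite collection of congruences $r_i\pmod{m_i}$, $1\le i\le \nu$, such that every integer $n$ satisfies $n\equiv r_i\pmod{m_i}$ for at least one $i$. For integers $b\geq 2$ and $w\geq 1$, a prime $p$ is a primitive prime divisor of $b^w-1$ if $p\mid b^w-1$ and $p\nmid b^\ell-1$ for all $1\leq \ell<w$. A covering system $\mathcal{C}=\{r_i\pmod{m_i}:1\leq i\leq\nu\}$ is called $b$-primitive if there exist distinct primes $p_1,\ldots,p_\nu$ such that, for each $i$, $p_i$ is a primitive prime divisor of $b^{m_i}-1$. For a $b$-primitive covering system $\mathcal{C}$, $\mathcal{P}_b(\mathcal{C})=\{p_1,\ldots,p_\nu\}$ denotes a (fixed, arbitrary) choice of such primes. *)

theory Defs
  imports "HOL-Number_Theory.Number_Theory"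
begin

(* A finite collection of congruences r_i (mod m_i) is a list of pairs (r_i, m_i), so that the
   index i of the collection is a list position and congruences may repeat. The moduli are
   required to be positive, since congruence modulo 0 would be equality. *)

definition covering_system :: "(int \<times> nat) list \<Rightarrow> bool" where
  "covering_system C \<longleftrightarrow>
     (\<forall>(r, m) \<in> set C. 1 \<le> m) \<and>
     (\<forall>n :: int. \<exists>(r, m) \<in> set C. [n = r] (mod int m))"

(* Used for b \<ge> 2 and w \<ge> 1 only. *)

definition primitive_prime_divisor :: "int \<Rightarrow> nat \<Rightarrow> int \<Rightarrow> bool" where
  "primitive_prime_divisor b w p \<longleftrightarrow>
     prime p \<and> p dvd b ^ w - 1 \<and> (\<forall>l. 1 \<le> l \<and> l < w \<longrightarrow> \<not> p dvd b ^ l - 1)"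

(* ps lists primes p_1, ..., p_nu witnessing that C is b-primitive, in the order of C;
   the associated set of primitive prime divisors is "set ps". *)

definition primitive_primes_of :: "int \<Rightarrow> (int \<times> nat) list \<Rightarrow> int list \<Rightarrow> bool" where
  "primitive_primes_of b C ps \<longleftrightarrow>
     length ps = length C \<and> distinct ps \<and>
     (\<forall>i < length C. primitive_prime_divisor b (snd (C ! i)) (ps ! i))"

definition b_primitive :: "int \<Rightarrow> (int \<times> nat) list \<Rightarrow> bool" where
  "b_primitive b C \<longleftrightarrow> covering_system C \<and> (\<exists>ps. primitive_primes_of b C ps)"

definition composite :: "int \<Rightarrow> bool" where
  "composite n \<longleftrightarrow> 1 < n \<and> \<not> prime n"

end

theory Submission
  imports Defs
begin

text \<open>
  Since \<open>p\<^sub>i\<close> divides \<open>b ^ m\<^sub>i - 1\<close>, the residue of \<open>t * b ^ t\<close> modulo \<open>p\<^sub>i\<close> depends only on \<open>t\<close> modulo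
  \<open>m\<^sub>i\<close> and \<open>p\<^sub>i\<close>. So fix \<open>t\<close> modulo \<open>2 ^ (q - 1)\<close>, \<open>b - 1\<close> and \<open>q\<close> first, and then choose \<open>t\<close> modulo
  \<open>p\<^sub>i\<close> such that \<open>p\<^sub>i\<close> divides \<open>(t * b ^ t + \<alpha>) * b ^ n + \<beta>\<close> for all \<open>n\<close> in the \<open>i\<close>-th class. The only
  collision is \<open>p\<^sub>i = q\<close>; then \<open>m\<^sub>i\<close> is a power of 2 by Fermat, and \<open>t\<close> modulo \<open>q\<close> may be chosen
  after \<open>t\<close> modulo \<open>2 ^ (q - 1)\<close>.

  The hypothesis on \<open>Max (set ps)\<close> still allows \<open>(t * b ^ t + \<alpha>) * b + \<beta>\<close> to equal that prime, for at
  most one \<open>t\<close>. Both \<open>t + \<alpha> + \<beta> \<equiv> 1\<close> and \<open>t + \<alpha> + \<beta> \<equiv> -1\<close> modulo \<open>lcm (2 ^ (q - 1)) (b - 1)\<close> are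
  suitable starting points and lead to different classes modulo \<open>M\<close>, one of which avoids this \<open>t\<close>.
\<close>

section \<open>Powers of \<open>b\<close> modulo primitive prime divisors, and simultaneous
  congruences\<close>

lemma cong_power_exponent_nat:
  fixes b p :: int
  assumes "p dvd b ^ m - 1" "[i = j] (mod m)"
  shows "[b ^ i = b ^ j] (mod p)"
proof -
  have one: "[b ^ m = 1] (mod p)"
    using assms(1) by (simp add: cong_iff_dvd_diff)
  have reduce: "[b ^ k = b ^ (k mod m)] (mod p)" for k
  proof -
    have "b ^ k = (b ^ m) ^ (k div m) * b ^ (k mod m)"
      by (simp flip: power_mult power_add)
    moreover have "[(b ^ m) ^ (k div m) * b ^ (k mod m) = 1 ^ (k div m) * b ^ (k mod m)] (mod p)"
      by (intro cong_mult cong_pow one cong_refl)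
    ultimately show ?thesis by simp
  qed
  have "i mod m = j mod m"
    using assms(2) by (simp add: cong_def)
  then show ?thesis
    using reduce[of i] reduce[of j] by (metis cong_sym cong_trans)
qed

lemma coprime_base_if_dvd_power_minus_1:
  fixes b p :: int
  assumes "prime p" "p dvd b ^ m - 1" "1 \<le> m"
  shows "coprime b p"
proof -
  have "\<not> p dvd b"
  proof
    assume "p dvd b"
    then have "p dvd b ^ m"
      using \<open>1 \<le> m\<close> by (simp add: dvd_trans[OF _ dvd_power])
    then have "p dvd b ^ m - (b ^ m - 1)"
      using assms(2) by (rule dvd_diff)
    then show False
      using \<open>prime p\<close> by (simp add: not_prime_unit)
  qed
  then show ?thesis
    using \<open>prime p\<close> prime_imp_coprime coprime_commute by blast
qed

text \<open>The class of \<open>t\<close> modulo \<open>m\<close> fixes \<open>b ^ t\<close> modulo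
  \<open>p\<close>, and the class of \<open>n\<close> fixes \<open>b ^ n\<close>. What remains is a
  linear congruence for \<open>t\<close> modulo \<open>p\<close>, solvable because \<open>b\<close>
  is invertible there. Hence one \<open>c\<close> serves the whole class of
  \<open>n\<close>.\<close>

lemma residue_making_divisible:
  fixes b p r \<alpha> \<beta> :: int and t\<^sub>0 m :: nat
  assumes "prime p" "p dvd b ^ m - 1" "1 \<le> m"
  obtains c where "\<And>(t::nat) (n::nat). \<lbrakk>[int t = c] (mod p); [t = t\<^sub>0] (mod m); [int n = r] (mod int m)\<rbrakk>
    \<Longrightarrow> p dvd (int t * b ^ t + \<alpha>) * b ^ n + \<beta>"
proof -
  have cop: "coprime (b ^ k) p" for k
    using coprime_base_if_dvd_power_minus_1[OF assms] by simp
  \<comment> \<open>A natural representative of \<open>r\<close>, so that it can stand as an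
    exponent.\<close>
  define k where "k = nat (r mod int m)"
  have k: "[int k = r] (mod int m)"
    using \<open>1 \<le> m\<close> by (simp add: k_def)
  obtain u where u: "[b ^ t\<^sub>0 * u = 1] (mod p)"
    using cong_solve_coprime_int[OF cop] by blast
  obtain v where v: "[b ^ k * v = 1] (mod p)"
    using cong_solve_coprime_int[OF cop] by blast
  \<comment> \<open>The solution of
    \<open>(c * b ^ t\<^sub>0 + \<alpha>) * b ^ k + \<beta> = 0\<close> modulo \<open>p\<close>,
    with \<open>u\<close> and \<open>v\<close> the inverses of \<open>b ^ t\<^sub>0\<close> and
    \<open>b ^ k\<close>.\<close>
  define c where "c = (- \<beta> * v - \<alpha>) * u"
  have "p dvd (int t * b ^ t + \<alpha>) * b ^ n + \<beta>"
    if "[int t = c] (mod p)" "[t = t\<^sub>0] (mod m)" "[int n = r] (mod int m)" for t n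
  proof -
    have "[n = k] (mod m)"
      using cong_trans[OF that(3) cong_sym[OF k]] by (simp add: cong_int_iff)
    then have bn: "[b ^ n = b ^ k] (mod p)"
      using assms(2) by (rule cong_power_exponent_nat[rotated])
    have bt: "[b ^ t = b ^ t\<^sub>0] (mod p)"
      using assms(2) that(2) by (rule cong_power_exponent_nat)
    have "[(int t * b ^ t + \<alpha>) * b ^ n + \<beta> = (c * b ^ t\<^sub>0 + \<alpha>) * b ^ k + \<beta>] (mod p)"
      by (intro cong_add cong_mult cong_refl that(1) bt bn)
    also have "(c * b ^ t\<^sub>0 + \<alpha>) * b ^ k + \<beta>
        = ((- \<beta> * v - \<alpha>) * (b ^ t\<^sub>0 * u) + \<alpha>) * b ^ k + \<beta>"
      by (simp add: c_def algebra_simps)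
    also have "[\<dots> = ((- \<beta> * v - \<alpha>) * 1 + \<alpha>) * b ^ k + \<beta>] (mod p)"
      by (intro cong_add cong_mult cong_refl u)
    also have "((- \<beta> * v - \<alpha>) * 1 + \<alpha>) * b ^ k + \<beta> = \<beta> - \<beta> * (b ^ k * v)"
      by (simp add: algebra_simps)
    also have "[\<dots> = \<beta> - \<beta> * 1] (mod p)"
      by (intro cong_diff cong_mult cong_refl v)
    finally show ?thesis
      by (simp add: cong_0_iff)
  qed
  then show ?thesis by (rule that)
qed

text \<open>The base modulus \<open>L\<close> is kept apart from the family, so that residues can be
  imposed in two stages: the residue reached in the first becomes the base condition of the
  second.\<close>

lemma chinese_remainder_extend_int:
  fixes p c :: "'a \<Rightarrow> int"
  assumes "finite I"
    and "\<And>i. i \<in> I \<Longrightarrow> coprime (p i) L"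
    and "\<And>i j. \<lbrakk>i \<in> I; j \<in> I; i \<noteq> j\<rbrakk> \<Longrightarrow> coprime (p i) (p j)"
  shows "\<exists>x. [x = a] (mod L) \<and> (\<forall>i\<in>I. [x = c i] (mod p i))"
  using assms
proof (induction I)
  case empty
  then show ?case by (auto intro: cong_refl)
next
  case (insert i I)
  then obtain x where x: "[x = a] (mod L)" "\<forall>j\<in>I. [x = c j] (mod p j)"
    by fastforce
  have "coprime (p i) (L * (\<Prod>j\<in>I. p j))"
    using insert.prems insert.hyps by (auto intro!: prod_coprime_right)
  then obtain y where y: "[y = c i] (mod p i)" "[y = x] (mod L * (\<Prod>j\<in>I. p j))"
    using binary_chinese_remainder_int by blast
  have "[y = x] (mod L)"
    using y(2) by (rule cong_dvd_modulus) simp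
  moreover have "[y = x] (mod p j)" if "j \<in> I" for j
    using y(2) that \<open>finite I\<close> by (intro cong_dvd_modulus[OF y(2)] dvd_mult dvd_prodI)
  ultimately have "[y = a] (mod L) \<and> (\<forall>j\<in>insert i I. [y = c j] (mod p j))"
    using x y(1) by (blast intro: cong_trans)
  then show ?case ..
qed

text \<open>By Fermat \<open>b ^ q\<close> is congruent to \<open>b\<close> modulo \<open>q\<close>,
  hence \<open>b ^ (w * q)\<close> to \<open>b ^ w\<close>. So \<open>q\<close> already divides
  \<open>b ^ w - 1\<close> with the smaller exponent \<open>w\<close>, against primitivity.\<close>

lemma not_primitive_prime_divisor_multiple:
  fixes b :: int
  assumes "prime q" "1 \<le> w" "0 \<le> b"
  shows "\<not> primitive_prime_divisor b (w * q) (int q)"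
proof
  assume prim: "primitive_prime_divisor b (w * q) (int q)"
  have q: "2 \<le> q"
    using \<open>prime q\<close> by (rule prime_ge_2_nat)
  have dvd: "int q dvd b ^ (w * q) - 1"
    using prim by (simp add: primitive_prime_divisor_def)
  have "coprime b (int q)"
    using assms q coprime_base_if_dvd_power_minus_1[OF _ dvd] by simp
  then have "coprime (nat b) q"
    using \<open>0 \<le> b\<close> by (metis coprime_int_iff int_nat_eq)
  then have "\<not> q dvd nat b"
    using \<open>prime q\<close> not_prime_unit coprime_common_divisor dvd_refl by blast
  then have "[nat b ^ (q - 1) = 1] (mod q)"
    using \<open>prime q\<close> fermat_theorem by blast
  then have "[b ^ (q - 1) = 1] (mod int q)"
    using \<open>0 \<le> b\<close> by (metis cong_int_iff int_nat_eq of_nat_1 of_nat_power)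
  then have "[b ^ (q - 1) * b = 1 * b] (mod int q)"
    by (intro cong_mult cong_refl)
  moreover have "b ^ (q - 1) * b = b ^ q"
    using q by (simp flip: power_Suc2)
  ultimately have "[b ^ q = b] (mod int q)"
    by simp
  then have "[(b ^ q) ^ w = b ^ w] (mod int q)"
    by (rule cong_pow)
  then have "[b ^ (w * q) = b ^ w] (mod int q)"
    by (simp add: mult.commute flip: power_mult)
  moreover have "[b ^ (w * q) = 1] (mod int q)"
    using dvd by (simp add: cong_iff_dvd_diff)
  ultimately have "int q dvd b ^ w - 1"
    by (metis cong_iff_dvd_diff cong_sym cong_trans)
  then show False
    using prim assms q by (auto simp: primitive_prime_divisor_def)
qed

section \<open>Growth of \<open>t * b ^ t\<close> and a criterion for compositeness\<close>

lemma int_mult_power_strict_mono: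
  fixes b :: int
  assumes "2 \<le> b" "s < t"
  shows "int s * b ^ s < int t * b ^ t"
proof -
  have "int s * b ^ s \<le> int s * b ^ t"
    using assms by (intro mult_left_mono power_increasing) auto
  also have "\<dots> < int t * b ^ t"
    using assms by (intro mult_strict_right_mono) auto
  finally show ?thesis .
qed

lemma composite_if_prime_dvd_less:
  assumes "prime p" "p dvd n" "p < n"
  shows "composite n"
proof -
  have "1 < n"
    using assms prime_gt_1_int[of p] by simp
  moreover have "\<not> prime n"
    using assms primes_dvd_imp_eq by blast
  ultimately show ?thesis
    by (simp add: composite_def)
qed

section \<open>Classes of \<open>t\<close> in which the covering forces a prime factor for every
  \<open>n\<close>\<close>

lemma covering_residue_class:
  fixes b \<alpha> \<beta> M s :: int and q :: nat
    and C :: "(int \<times> nat) list" and ps :: "int list"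
  assumes b: "b \<ge> 2" and q: "prime q" "q \<noteq> 2" and cov: "covering_system C"
    and moduli: "\<And>m. m \<in> snd ` set C \<Longrightarrow>
      m \<noteq> 1 \<and> (m dvd 2 ^ (q - 1) \<or> (\<exists>j\<le>q - 1. m = 2 ^ j * q))"
    and ps: "primitive_primes_of b C ps"
    and M: "M = Lcm ({2 ^ (q - 1), b - 1, int q} \<union> set ps)"
  shows "\<exists>T. [T = s] (mod lcm (2 ^ (q - 1)) (b - 1)) \<and>
    (\<forall>t::nat. [int t = T] (mod M) \<longrightarrow>
      (\<forall>n::nat. \<exists>p\<in>set ps. p dvd (int t * b ^ t + \<alpha>) * b ^ n + \<beta>))"
proof -
  define N where "N = length C"
  define r where "r i = fst (C ! i)" for i
  define m where "m i = snd (C ! i)" for i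
  define p where "p i = ps ! i" for i
  define L where "L = lcm (2 ^ (q - 1)) (b - 1)"
  define L' where "L' = lcm L (int q)"
  have len: "length ps = N" and dist: "distinct ps"
    and prim: "primitive_prime_divisor b (m i) (p i)" if "i < N" for i
    using ps that by (auto simp: primitive_primes_of_def N_def m_def p_def)
  have m_in: "m i \<in> snd ` set C" if "i < N" for i
    using that by (auto simp: m_def N_def)
  have prime_p: "prime (p i)" and dvd_p: "p i dvd b ^ m i - 1" if "i < N" for i
    using prim[OF that] by (auto simp: primitive_prime_divisor_def)
  have m_pos: "1 \<le> m i" if "i < N" for i
    using cov m_in[OF that] by (auto simp: covering_system_def)
  \<comment> \<open>As \<open>m i > 1\<close>, primitivity applies to the exponent 1.\<close>
  have not_b1: "\<not> p i dvd b - 1" if "i < N" for i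
  proof -
    have "1 < m i"
      using m_pos[OF that] moduli[OF m_in[OF that]] by simp
    then show ?thesis
      using prim[OF that] unfolding primitive_prime_divisor_def
      by (metis le_refl power_one_right)
  qed
  have not_2: "p i \<noteq> 2" if "i < N" for i
  proof
    assume two: "p i = 2"
    then have "even (b ^ m i - 1)"
      using dvd_p[OF that] by simp
    then have "even (b - 1)"
      using m_pos[OF that] by (cases "even b") auto
    then show False
      using not_b1[OF that] two by simp
  qed
  \<comment> \<open>This is what leaves the residue \<open>s\<close> modulo \<open>L\<close> free:
    conditions modulo the \<open>p i\<close> cannot conflict with it.\<close>
  have cop_L: "coprime (p i) L" if "i < N" for i
  proof -
    have "\<not> p i dvd 2"
      using not_2[OF that] prime_p[OF that] primes_dvd_imp_eq[of "p i" 2] by auto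
    then have "\<not> p i dvd 2 ^ (q - 1) * (b - 1)"
      using prime_p[OF that] not_b1[OF that] prime_dvd_mult_iff prime_dvd_power by blast
    moreover have "L dvd 2 ^ (q - 1) * (b - 1)"
      by (simp add: L_def)
    ultimately have "\<not> p i dvd L"
      using dvd_trans by blast
    then show ?thesis
      using prime_p[OF that] by (rule prime_imp_coprime[rotated])
  qed
  have p_inj: "p i \<noteq> p j" if "i < N" "j < N" "i \<noteq> j" for i j
    using that dist len by (simp add: p_def nth_eq_iff_index_eq)
  have cop_p: "coprime (p i) (p j)" if "i < N" "j < N" "i \<noteq> j" for i j
    using p_inj[OF that] prime_p that primes_coprime by blast
  have "L > 0" "L' > 0"
    using b q prime_gt_0_nat[OF q(1)] by (auto simp: L_def L'_def lcm_pos_int)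

  \<comment> \<open>The class of \<open>t\<close> modulo \<open>m i\<close> is left as a parameter
    \<open>t\<^sub>0\<close>, because the two stages below instantiate it differently.\<close>
  have ex_c: "\<exists>c. \<forall>(t::nat) (n::nat). [int t = c] (mod p i) \<longrightarrow> [t = t\<^sub>0] (mod m i) \<longrightarrow>
      [int n = r i] (mod int (m i)) \<longrightarrow> p i dvd (int t * b ^ t + \<alpha>) * b ^ n + \<beta>"
    if "i < N" for i t\<^sub>0
    by (rule residue_making_divisible[OF prime_p[OF that] dvd_p[OF that] m_pos[OF that]]) blast
  then obtain c where c: "\<And>i t\<^sub>0 t n. \<lbrakk>i < N; [int t = c i t\<^sub>0] (mod p i); [t = t\<^sub>0] (mod m i);
      [int n = r i] (mod int (m i))\<rbrakk> \<Longrightarrow> p i dvd (int t * b ^ t + \<alpha>) * b ^ n + \<beta>"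
    by metis

  define t\<^sub>1 where "t\<^sub>1 = nat (s mod L)"
  have t\<^sub>1: "[int t\<^sub>1 = s] (mod L)"
    using \<open>L > 0\<close> by (simp add: t\<^sub>1_def)
  \<comment> \<open>First stage: only an index with \<open>p i = int q\<close> is treated, and there
    is at most one. Its modulus will divide \<open>L\<close>, so \<open>t\<^sub>1\<close> already
    determines \<open>t\<close> modulo \<open>m i\<close>.\<close>
  have "\<exists>x. [x = s] (mod L) \<and> (\<forall>i\<in>{i. i < N \<and> p i = int q}. [x = c i t\<^sub>1] (mod p i))"
    by (rule chinese_remainder_extend_int) (use cop_L cop_p in \<open>simp, blast, blast\<close>)
  then obtain x where x: "[x = s] (mod L)"
      "\<And>i. \<lbrakk>i < N; p i = int q\<rbrakk> \<Longrightarrow> [x = c i t\<^sub>1] (mod p i)"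
    by blast
  \<comment> \<open>\<open>L'\<close> is a multiple of every modulus \<open>m i\<close>, including
    the \<open>2 ^ j * q\<close>, so \<open>t\<^sub>2\<close> determines \<open>t\<close> modulo
    each of them.\<close>
  define t\<^sub>2 where "t\<^sub>2 = nat (x mod L')"
  have t\<^sub>2: "[int t\<^sub>2 = x] (mod L')"
    using \<open>L' > 0\<close> by (simp add: t\<^sub>2_def)
  have cop_L': "coprime (p i) L'" if "i < N" "p i \<noteq> int q" for i
  proof -
    have "coprime (p i) (int q)"
      using primes_coprime[of "p i" "int q"] prime_p[OF that(1)] that(2) q by simp
    then have "coprime (p i) (L * int q)"
      using cop_L[OF that(1)] by simp
    moreover have "L' dvd L * int q"
      by (simp add: L'_def)
    ultimately show ?thesis
      using coprime_divisors dvd_refl by blast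
  qed
  \<comment> \<open>Second stage: keeping \<open>x\<close> modulo \<open>L'\<close> preserves its
    residue modulo \<open>q\<close>, and with it the condition from the first stage.\<close>
  have "\<exists>T. [T = x] (mod L') \<and> (\<forall>i\<in>{i. i < N \<and> p i \<noteq> int q}. [T = c i t\<^sub>2] (mod p i))"
    by (rule chinese_remainder_extend_int) (use cop_L' cop_p in \<open>simp, blast, blast\<close>)
  then obtain T where T: "[T = x] (mod L')"
      "\<And>i. \<lbrakk>i < N; p i \<noteq> int q\<rbrakk> \<Longrightarrow> [T = c i t\<^sub>2] (mod p i)"
    by blast

  have L_dvd: "L dvd L'" "int q dvd L'" "2 ^ (q - 1) dvd L"
    by (auto simp: L'_def L_def)
  have dvd_L: "int w dvd L" if "w dvd 2 ^ (q - 1)" for w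
  proof -
    have "int w dvd int (2 ^ (q - 1))"
      using that by (simp only: int_dvd_int_iff)
    then show ?thesis
      using dvd_trans[OF _ L_dvd(3)] by simp
  qed
  have L'_dvd: "L' dvd M"
    unfolding L'_def L_def M by (intro lcm_least dvd_Lcm) auto
  have p_dvd: "p i dvd M" if "i < N" for i
    unfolding M p_def using that len by (intro dvd_Lcm) auto

  have "\<exists>p\<in>set ps. p dvd (int t * b ^ t + \<alpha>) * b ^ n + \<beta>"
    if t: "[int t = T] (mod M)" for t n
  proof -
    obtain rm where rm: "rm \<in> set C" "[int n = fst rm] (mod int (snd rm))"
      using cov by (force simp: covering_system_def)
    then obtain i where i: "i < N" "[int n = r i] (mod int (m i))"
      by (metis N_def in_set_conv_nth m_def r_def)
    have tx: "[int t = x] (mod L')"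
      using cong_dvd_modulus[OF t L'_dvd] T(1) by (rule cong_trans)
    have "p i dvd (int t * b ^ t + \<alpha>) * b ^ n + \<beta>"
    proof (cases "p i = int q")
      case True
      have "m i dvd 2 ^ (q - 1)"
      proof -
        have "\<not> primitive_prime_divisor b (2 ^ j * q) (p i)" for j
          unfolding True using b by (intro not_primitive_prime_divisor_multiple q(1)) simp_all
        then have "m i \<noteq> 2 ^ j * q" for j
          using prim[OF i(1)] by metis
        then show ?thesis
          using moduli[OF m_in[OF i(1)]] by metis
      qed
      then have "int (m i) dvd L"
        by (rule dvd_L)
      moreover have "[int t = int t\<^sub>1] (mod L)"
        using cong_dvd_modulus[OF tx L_dvd(1)] x(1) t\<^sub>1 by (metis cong_sym cong_trans)
      ultimately have "[t = t\<^sub>1] (mod m i)"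
        using cong_dvd_modulus cong_int_iff by blast
      moreover have "[int t = c i t\<^sub>1] (mod p i)"
        using cong_dvd_modulus[OF tx L_dvd(2)] x(2)[OF i(1) True] True by (metis cong_trans)
      ultimately show ?thesis
        using c i by blast
    next
      case False
      have "int (m i) dvd L'"
      proof -
        have "int (2 ^ j * q) dvd L'" if "j \<le> q - 1" for j
        proof -
          have "(2::int) ^ j dvd L'"
            using dvd_trans[OF dvd_L[OF le_imp_power_dvd[OF that]] L_dvd(1)] by simp
          moreover have "coprime (2::int) (int q)"
            by (rule primes_coprime) (use q in auto)
          then have "coprime (2 ^ j) (int q)"
            by simp
          ultimately have "2 ^ j * int q dvd L'"
            using L_dvd(2) by (intro divides_mult)
          then show ?thesis
            by simp
        qed
        moreover have "int w dvd L'" if "w dvd 2 ^ (q - 1)" for w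
          by (rule dvd_trans[OF dvd_L[OF that] L_dvd(1)])
        ultimately show ?thesis
          using moduli[OF m_in[OF i(1)]] by metis
      qed
      moreover have "[int t = int t\<^sub>2] (mod L')"
        using tx t\<^sub>2 by (metis cong_sym cong_trans)
      ultimately have "[t = t\<^sub>2] (mod m i)"
        using cong_dvd_modulus cong_int_iff by blast
      moreover have "[int t = c i t\<^sub>2] (mod p i)"
        using cong_dvd_modulus[OF t p_dvd[OF i(1)]] T(2)[OF i(1) False] by (rule cong_trans)
      ultimately show ?thesis
        using c i by blast
    qed
    then show ?thesis
      using i(1) len by (auto simp: p_def)
  qed
  moreover have "[T = s] (mod L)"
    using cong_dvd_modulus[OF T(1) L_dvd(1)] x(1) by (rule cong_trans)
  ultimately show ?thesis
    unfolding L_def by blast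
qed

section \<open>Choice between two classes, coprimality to \<open>b - 1\<close>, and
  compositeness\<close>

theorem theorem3p1:
  fixes b \<alpha> \<beta> M :: int and q :: nat
    and C :: "(int \<times> nat) list" and ps :: "int list"
  assumes "b \<ge> 2"
    and "\<not> (\<exists>k :: nat. b + 1 = 2 ^ k)"
    and "\<alpha> * \<beta> \<noteq> 0"
    and "prime q" and "q \<ge> 5"
    and "b_primitive b C"
    and "distinct (map snd C)"
    and "set (map snd C) = {2 ^ j | j. 1 \<le> j \<and> j \<le> q - 1} \<union> {2 ^ j * q | j. j \<le> q - 1}"
    and "primitive_primes_of b C ps"
    and "M = Lcm ({2 ^ (q - 1), b - 1, int q} \<union> set ps)"
  shows "\<exists>T :: int. \<forall>t :: nat.
           [int t = T] (mod M) \<and>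
           int t * b ^ t + \<alpha> > 0 \<and>
           (int t * b ^ t + \<alpha>) * b + \<beta> \<ge> Max (set ps) \<longrightarrow>
             gcd (int t * b ^ t + \<alpha> + \<beta>) (b - 1) = 1 \<and>
             (\<forall>n :: nat. n \<ge> 1 \<longrightarrow> composite ((int t * b ^ t + \<alpha>) * b ^ n + \<beta>))"
proof -
  define L where "L = lcm (2 ^ (q - 1)) (b - 1)"
  have L_dvd_M: "L dvd M"
    unfolding L_def assms(10) by (intro lcm_least dvd_Lcm) auto
  have cov: "covering_system C"
    using assms(6) by (simp add: b_primitive_def)
  have moduli: "m \<noteq> 1 \<and> (m dvd 2 ^ (q - 1) \<or> (\<exists>j\<le>q - 1. m = 2 ^ j * q))"
    if "m \<in> snd ` set C" for m
  proof -
    have "(\<exists>j. 1 \<le> j \<and> j \<le> q - 1 \<and> m = 2 ^ j) \<or> (\<exists>j\<le>q - 1. m = 2 ^ j * q)"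
      using that assms(8) by auto
    then show ?thesis
      using \<open>q \<ge> 5\<close> by (auto intro: le_imp_power_dvd)
  qed
  \<comment> \<open>The shift makes \<open>t + \<alpha> + \<beta>\<close> congruent to
    \<open>s\<close> modulo \<open>L\<close>; a unit \<open>s\<close> will then give gcd 1.\<close>
  have "\<exists>T. [T = s - \<alpha> - \<beta>] (mod L) \<and>
    (\<forall>t::nat. [int t = T] (mod M) \<longrightarrow>
      (\<forall>n::nat. \<exists>p\<in>set ps. p dvd (int t * b ^ t + \<alpha>) * b ^ n + \<beta>))" for s
    unfolding L_def by (rule covering_residue_class) (use assms cov moduli in auto)
  then obtain T where T: "\<And>s. [T s = s - \<alpha> - \<beta>] (mod L)"
      "\<And>s t n. [int t = T s] (mod M) \<Longrightarrow>
        \<exists>p\<in>set ps. p dvd (int t * b ^ t + \<alpha>) * b ^ n + \<beta>"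
    by metis

  \<comment> \<open>The classes differ by 2 modulo \<open>L\<close>, whereas 4 divides
    \<open>L\<close> because \<open>q - 1\<close> is at least 2.\<close>
  have distinct_classes: "\<not> [T 1 = T (- 1)] (mod M)"
  proof
    assume "[T 1 = T (- 1)] (mod M)"
    then have "[T 1 = T (- 1)] (mod L)"
      using L_dvd_M by (rule cong_dvd_modulus)
    then have "[1 - \<alpha> - \<beta> = - 1 - \<alpha> - \<beta>] (mod L)"
      using T(1) by (metis cong_sym cong_trans)
    then have "L dvd 2"
      by (simp add: cong_iff_dvd_diff)
    moreover have "2 ^ 2 dvd (2::int) ^ (q - 1)"
      using \<open>q \<ge> 5\<close> by (intro le_imp_power_dvd) simp
    then have "4 dvd L"
      unfolding L_def by (metis dvd_lcm1 dvd_trans power2_eq_square mult_2 numeral_Bit0)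
    ultimately have "(4::int) dvd 2"
      using dvd_trans by blast
    then show False by simp
  qed
  define bad where "bad t \<longleftrightarrow> (int t * b ^ t + \<alpha>) * b + \<beta> = Max (set ps)" for t
  have bad_unique: "t = u" if "bad t" "bad u" for t u
  proof -
    have "(int t * b ^ t + \<alpha>) * b = (int u * b ^ u + \<alpha>) * b"
      using that unfolding bad_def by linarith
    then have "int t * b ^ t = int u * b ^ u"
      using \<open>b \<ge> 2\<close> by simp
    then show ?thesis
      using \<open>b \<ge> 2\<close> int_mult_power_strict_mono[of b t u] int_mult_power_strict_mono[of b u t]
      by (cases t u rule: linorder_cases) simp_all
  qed
  \<comment> \<open>If both classes contained a bad \<open>t\<close>, uniqueness would make it the
    same number, and the classes would coincide modulo \<open>M\<close>.\<close>
  obtain s where s: "s \<in> {1, - 1}" "\<And>t. [int t = T s] (mod M) \<Longrightarrow> \<not> bad t"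
    using distinct_classes bad_unique by (metis cong_sym cong_trans insertCI)

  have "gcd (int t * b ^ t + \<alpha> + \<beta>) (b - 1) = 1 \<and>
      (\<forall>n\<ge>1. composite ((int t * b ^ t + \<alpha>) * b ^ n + \<beta>))"
    if t: "[int t = T s] (mod M)" and pos: "int t * b ^ t + \<alpha> > 0"
      and ge: "(int t * b ^ t + \<alpha>) * b + \<beta> \<ge> Max (set ps)" for t
  proof (intro conjI allI impI)
    have "[int t = s - \<alpha> - \<beta>] (mod L)"
      using cong_dvd_modulus[OF t L_dvd_M] T(1) by (rule cong_trans)
    then have ts: "[int t = s - \<alpha> - \<beta>] (mod b - 1)"
      by (rule cong_dvd_modulus) (simp add: L_def)
    \<comment> \<open>The powers of \<open>b\<close> vanish modulo \<open>b - 1\<close>, leaving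
      \<open>t + \<alpha> + \<beta>\<close>, that is, \<open>s\<close>.\<close>
    have "[b = 1] (mod b - 1)"
      by (simp add: cong_iff_dvd_diff)
    then have "[int t * b ^ t + \<alpha> + \<beta> = (s - \<alpha> - \<beta>) * 1 ^ t + \<alpha> + \<beta>] (mod b - 1)"
      by (intro cong_add cong_mult cong_pow cong_refl ts)
    then have "gcd (int t * b ^ t + \<alpha> + \<beta>) (b - 1) = gcd s (b - 1)"
      by (simp add: cong_gcd_eq)
    then show "gcd (int t * b ^ t + \<alpha> + \<beta>) (b - 1) = 1"
      using s(1) by auto
  next
    fix n :: nat
    assume "1 \<le> n"
    obtain p where p: "p \<in> set ps" "p dvd (int t * b ^ t + \<alpha>) * b ^ n + \<beta>"
      using T(2)[OF t] by blast
    have "prime p"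
      using p(1) assms(9)
      by (auto simp: primitive_primes_of_def primitive_prime_divisor_def in_set_conv_nth)
    have "p \<le> Max (set ps)"
      using p(1) by simp
    \<comment> \<open>Strict because \<open>t\<close> is not bad; so the prime \<open>p\<close> is a
      proper divisor. Positivity of the coefficient then carries the bound from exponent 1 to every
      \<open>n\<close>.\<close>
    also have "\<dots> < (int t * b ^ t + \<alpha>) * b + \<beta>"
      using ge s(2)[OF t] by (simp add: bad_def)
    also have "\<dots> \<le> (int t * b ^ t + \<alpha>) * b ^ n + \<beta>"
      using pos \<open>b \<ge> 2\<close> \<open>1 \<le> n\<close> self_le_power[of b n] by simp
    finally show "composite ((int t * b ^ t + \<alpha>) * b ^ n + \<beta>)"
      using \<open>prime p\<close> p(2) composite_if_prime_dvd_less by blast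
  qed
  then show ?thesis by blast
qed

end
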